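(* Let $X,Y$ be infinite-dimensional complex Hilbert spaces, let $W\in\mathcal{B}(Y,X)\setminus\{0\}$ and let $A\in\mathcal{B}(X,Y)$ be $W$g-Drazin invertible. Then, for $B\in\mathcal{B}(X,Y)$, the following statements are equivalent: (i) $B$ is the weighted weak group inverse of $A$, i.e. $B=A^{\otimes,W}$; (ii) $A^{\mathrm{cEP},W}WAWB=B$ and $AWB=A^{\mathrm{cEP},W}WA$; (iii) $BWAWB=B$, $AWB=A^{\mathrm{cEP},W}WA$ and $BWA^{\mathrm{cEP},W}=A^{\mathrm{cEP},W}WA^{\mathrm{cEP},W}$; (iv) $BWAWB=B$, $AWB=A^{\mathrm{cEP},W}WA$ and $BWA^{d,W}=A^{d,W}WA^{d,W}$.
   Context: $\mathcal{B}(X,Y)$ is the set of bounded linear operators from $X$ to $Y$, $\mathcal{B}(X)=\mathcal{B}(X,X)$; $R(\cdot)$ denotes range; $P_L$ is the orthogonal projector onto a closed subspace $L$. An operator $T\in\mathcal{B}(X)$ is generalized Drazin invertible if there is a (necessarily unique) $T^d\in\mathcal{B}(X)$ with $TT^d=T^dT$, $T^dTT^d=T^d$ and $T-T^2T^d$ quasinilpotent (and similarly on $Y$). For $W\in\mathcal{B}(Y,X)\setminus\{0\}$, an operator $A\in\mathcal{B}(X,Y)$ is $W$g-Drazin invertible if there is a (necessarily unique) $A^{d,W}=B\in\mathcal{B}(X,Y)$ with $AWB=BWA$, $BWAWB=B$ and $A-AWBWA$ quasinilpotent in the weighted sense, i.e. $(A-AWBWA)W$ is a quasinilpotent operator on $Y$.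 In that case $AW$ and $WA$ are generalized Drazin invertible with $(AW)^d=A^{d,W}W$ and $(WA)^d=WA^{d,W}$. If $A$ is $W$g-Drazin invertible, its weighted core-EP inverse $A^{\mathrm{cEP},W}$ is the unique (it exists) operator $B\in\mathcal{B}(X,Y)$ with $WAWB=P_{R((WA)^d)}$ and $R(B)\subseteq R((AW)^d)$. The weighted weak group inverse of $A$ is $A^{\otimes,W}=(A^{\mathrm{cEP},W}W)^2A$. *)

theory Defs
  imports "HOL-Analysis.Analysis"
begin

section \<open>Complex Hilbert spaces\<close>

text \<open>A complex inner product space carries in particular the structure of a real inner
  product space, whose inner product is the real part of the complex one. Hence norm and
  topology are those of \<^class>\<open>real_inner\<close>, and \<^term>\<open>norm x\<close> is the square root of
  the (real) value of the complex inner product of x with itself. The complex inner product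
  is linear in its first argument.\<close>

class complex_inner = real_inner +
  fixes scaleC :: "complex \<Rightarrow> 'a \<Rightarrow> 'a" (infixr \<open>*\<^sub>C\<close> 75)
    and cinner :: "'a \<Rightarrow> 'a \<Rightarrow> complex"
  assumes scaleC_add_right: "a *\<^sub>C (x + y) = a *\<^sub>C x + a *\<^sub>C y"
    and scaleC_add_left: "(a + b) *\<^sub>C x = a *\<^sub>C x + b *\<^sub>C x"
    and scaleC_scaleC: "a *\<^sub>C (b *\<^sub>C x) = (a * b) *\<^sub>C x"
    and scaleR_scaleC: "r *\<^sub>R x = complex_of_real r *\<^sub>C x"
    and cinner_commute: "cinner x y = cnj (cinner y x)"
    and cinner_add_left: "cinner (x + y) z = cinner x z + cinner y z"
    and cinner_scaleC_left: "cinner (a *\<^sub>C x) y = a * cinner x y"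
    and inner_eq_Re_cinner: "inner x y = Re (cinner x y)"

class complex_hilbert = complex_inner + complete_space

lemma scaleC_one: "1 *\<^sub>C (x :: 'a :: complex_inner) = x"
  using scaleR_scaleC[of 1 x] by simp

interpretation complex_vector:
  vector_space "scaleC :: complex \<Rightarrow> 'a \<Rightarrow> 'a :: complex_inner"
  by unfold_locales (simp_all add: scaleC_add_right scaleC_add_left scaleC_scaleC scaleC_one)

section \<open>Bounded operators\<close>

definition bounded_clinear :: "('a :: complex_inner \<Rightarrow> 'b :: complex_inner) \<Rightarrow> bool" where
  "bounded_clinear T \<longleftrightarrow> bounded_linear T \<and> (\<forall>c x. T (c *\<^sub>C x) = c *\<^sub>C T x)"

definition op_spectrum :: "('a :: complex_inner \<Rightarrow> 'a) \<Rightarrow> complex set" where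
  "op_spectrum T = {c. \<not> (\<exists>S. bounded_clinear S \<and>
      (\<lambda>x. c *\<^sub>C x - T x) \<circ> S = id \<and> S \<circ> (\<lambda>x. c *\<^sub>C x - T x) = id)}"

definition quasinilpotent :: "('a :: complex_inner \<Rightarrow> 'a) \<Rightarrow> bool" where
  "quasinilpotent T \<longleftrightarrow> op_spectrum T = {0}"

text \<open>The orthogonal projector onto a closed subspace \<open>L\<close>; it is unspecified for other
  sets \<open>L\<close>.\<close>

definition orth_proj :: "'a :: complex_inner set \<Rightarrow> 'a \<Rightarrow> 'a" where
  "orth_proj L x = (THE p. p \<in> L \<and> (\<forall>z\<in>L. cinner (x - p) z = 0))"

section \<open>Generalized inverses\<close>

definition is_gdrazin_inverse ::
    "('a :: complex_inner \<Rightarrow> 'a) \<Rightarrow> ('a \<Rightarrow> 'a) \<Rightarrow> bool" where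
  "is_gdrazin_inverse T S \<longleftrightarrow> bounded_clinear S \<and> T \<circ> S = S \<circ> T \<and> S \<circ> T \<circ> S = S \<and>
     quasinilpotent (\<lambda>x. T x - (T \<circ> T \<circ> S) x)"

definition gdrazin_inverse :: "('a :: complex_inner \<Rightarrow> 'a) \<Rightarrow> 'a \<Rightarrow> 'a" where
  "gdrazin_inverse T = (THE S. is_gdrazin_inverse T S)"

text \<open>In all weighted notions the weight \<open>W\<close> is the first argument.\<close>

definition is_wgdrazin_inverse ::
    "('b :: complex_inner \<Rightarrow> 'a :: complex_inner) \<Rightarrow> ('a \<Rightarrow> 'b) \<Rightarrow> ('a \<Rightarrow> 'b) \<Rightarrow> bool" where
  "is_wgdrazin_inverse W A B \<longleftrightarrow> bounded_clinear B \<and> A \<circ> W \<circ> B = B \<circ> W \<circ> A \<and>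
     B \<circ> W \<circ> A \<circ> W \<circ> B = B \<and>
     quasinilpotent ((\<lambda>x. A x - (A \<circ> W \<circ> B \<circ> W \<circ> A) x) \<circ> W)"

definition wgdrazin_invertible ::
    "('b :: complex_inner \<Rightarrow> 'a :: complex_inner) \<Rightarrow> ('a \<Rightarrow> 'b) \<Rightarrow> bool" where
  "wgdrazin_invertible W A \<longleftrightarrow> (\<exists>B. is_wgdrazin_inverse W A B)"

definition wgdrazin_inverse ::
    "('b :: complex_inner \<Rightarrow> 'a :: complex_inner) \<Rightarrow> ('a \<Rightarrow> 'b) \<Rightarrow> 'a \<Rightarrow> 'b" where
  "wgdrazin_inverse W A = (THE B. is_wgdrazin_inverse W A B)"

definition is_wcep_inverse ::
    "('b :: complex_inner \<Rightarrow> 'a :: complex_inner) \<Rightarrow> ('a \<Rightarrow> 'b) \<Rightarrow> ('a \<Rightarrow> 'b) \<Rightarrow> bool" where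
  "is_wcep_inverse W A B \<longleftrightarrow> bounded_clinear B \<and>
     W \<circ> A \<circ> W \<circ> B = orth_proj (range (gdrazin_inverse (W \<circ> A))) \<and>
     range B \<subseteq> range (gdrazin_inverse (A \<circ> W))"

definition wcep_inverse ::
    "('b :: complex_inner \<Rightarrow> 'a :: complex_inner) \<Rightarrow> ('a \<Rightarrow> 'b) \<Rightarrow> 'a \<Rightarrow> 'b" where
  "wcep_inverse W A = (THE B. is_wcep_inverse W A B)"

definition wweak_group_inverse ::
    "('b :: complex_inner \<Rightarrow> 'a :: complex_inner) \<Rightarrow> ('a \<Rightarrow> 'b) \<Rightarrow> 'a \<Rightarrow> 'b" where
  "wweak_group_inverse W A = ((wcep_inverse W A \<circ> W) ^^ 2) \<circ> A"

end

theory Submission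
  imports Defs "HOL-Complex_Analysis.Conformal_Mappings"
begin

text \<open>Let \<open>D\<close> be the weighted g-Drazin inverse of \<open>A\<close>. With \<open>P\<close> the
  orthogonal projector onto the closed subspace \<open>R(WD)\<close>, the weighted core-EP inverse is
  \<open>DP\<close>, and the equivalences reduce to algebra with the relations \<open>PWD = WD\<close> and
  \<open>WAWDP = P\<close>. The analytic part is that \<open>(WA)\<^sup>d = WD\<close> and \<open>(AW)\<^sup>d =
  DW\<close> are well defined. If the spectrum of \<open>N\<close> is contained in \<open>{0}\<close>, the
  resolvent \<open>(1 - zN)\<^sup>-\<^sup>1\<close> is entire, so the powers of \<open>N\<close> decay faster than
  any geometric sequence and \<open>Z = SZN\<close> forces \<open>Z = 0\<close>. Applied to differences of products
  of spectral idempotents this gives uniqueness of generalized Drazin inverses; applied to the identity it shows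
  that such an \<open>N\<close> on a nonzero space is not invertible, whence quasinilpotence passes from
  \<open>QW\<close> to \<open>WQ\<close>.\<close>

section \<open>Complex inner product spaces\<close>

lemma cinner_self: "cinner x x = complex_of_real ((norm x)\<^sup>2)"
proof (rule complex_eqI)
  show "Im (cinner x x) = Im (complex_of_real ((norm x)\<^sup>2))"
    using arg_cong[OF cinner_commute[of x x], of Im] by simp
qed (simp add: inner_eq_Re_cinner[symmetric] power2_norm_eq_inner)

lemma cinner_scaleC_right: "cinner x (c *\<^sub>C y) = cnj c * cinner x y"
  by (metis cinner_commute cinner_scaleC_left complex_cnj_mult)

lemma cinner_diff_left: "cinner (x - y) z = cinner x z - cinner y z"
  using cinner_add_left[of "x - y" y z] by simp

lemma cinner_zero_left: "cinner 0 z = 0"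
  using cinner_add_left[of 0 0 z] by simp

text \<open>The class ties the norm only to the real structure, so homogeneity under complex scalars
  is recovered from the complex inner product of \<open>c *\<^sub>C x\<close> with itself.\<close>

lemma norm_scaleC: "norm (c *\<^sub>C x) = cmod c * norm x"
proof -
  have "complex_of_real ((norm (c *\<^sub>C x))\<^sup>2) = c * cnj c * complex_of_real ((norm x)\<^sup>2)"
    by (simp only: cinner_self[symmetric] cinner_scaleC_left cinner_scaleC_right mult_ac)
  also have "\<dots> = complex_of_real ((cmod c * norm x)\<^sup>2)"
    by (simp only: complex_norm_square[symmetric] of_real_mult power_mult_distrib of_real_power)
  finally have "(norm (c *\<^sub>C x))\<^sup>2 = (cmod c * norm x)\<^sup>2"
    using of_real_eq_iff by blast
  then show ?thesis by (simp add: power2_eq_iff_nonneg)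
qed

lemma norm_cinner_le: "cmod (cinner x y) \<le> norm x * norm y"
proof -
  \<comment> \<open>Multiplying \<open>x\<close> by this phase makes the inner product real and
    nonnegative, so the real Cauchy-Schwarz inequality applies. As \<open>sgn 0 = 0\<close>, only
    \<open>cmod a \<le> 1\<close> holds in general.\<close>
  define a where "a = cnj (sgn (cinner x y))"
  have "a * cinner x y = complex_of_real (cmod (cinner x y))"
    unfolding a_def by (cases "cinner x y = 0")
      (simp_all add: sgn_eq complex_norm_square[symmetric] mult.commute power2_eq_square)
  then have "cmod (cinner x y) = inner (a *\<^sub>C x) y"
    by (simp add: inner_eq_Re_cinner cinner_scaleC_left)
  also have "\<dots> \<le> cmod a * norm x * norm y"
    using norm_cauchy_schwarz[of "a *\<^sub>C x" y] by (simp add: norm_scaleC)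
  also have "\<dots> \<le> 1 * norm x * norm y"
    by (intro mult_right_mono) (simp_all add: a_def norm_sgn)
  finally show ?thesis by simp
qed

lemma tendsto_cinner_left:
  fixes l y :: "'a :: complex_inner"
  assumes "(f \<longlongrightarrow> l) F"
  shows "((\<lambda>w. cinner (f w) y) \<longlongrightarrow> cinner l y) F"
proof -
  have "((\<lambda>w. cinner (f w) y - cinner l y) \<longlongrightarrow> 0) F"
  proof (rule Lim_null_comparison)
    show "\<forall>\<^sub>F w in F. norm (cinner (f w) y - cinner l y) \<le> norm (f w - l) * norm y"
      by (intro always_eventually allI) (simp add: cinner_diff_left[symmetric] norm_cinner_le)
    show "((\<lambda>w. norm (f w - l) * norm y) \<longlongrightarrow> 0) F"
      using assms by (intro tendsto_mult_left_zero tendsto_norm_zero LIM_zero)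
  qed
  then show ?thesis by (simp add: LIM_zero_iff)
qed

section \<open>Bounded complex-linear operators\<close>

context
  fixes T :: "'a :: complex_inner \<Rightarrow> 'b :: complex_inner"
  assumes T: "bounded_clinear T"
begin

lemma bounded_clinear_scaleC: "T (c *\<^sub>C x) = c *\<^sub>C T x"
  using T by (simp add: bounded_clinear_def)

lemma bounded_clinear_bounded_linear: "bounded_linear T"
  using T by (simp add: bounded_clinear_def)

lemma bounded_clinear_add: "T (x + y) = T x + T y"
  using bounded_clinear_bounded_linear by (rule linear_add[OF bounded_linear.linear])

lemma bounded_clinear_diff: "T (x - y) = T x - T y"
  using bounded_clinear_bounded_linear by (rule linear_diff[OF bounded_linear.linear])

lemma bounded_clinear_zero: "T 0 = 0"
  using bounded_clinear_diff[of 0 0] by simp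

lemma bounded_clinear_bound:
  obtains K where "K > 0" "\<And>x. norm (T x) \<le> K * norm x"
  using bounded_linear.pos_bounded[OF bounded_clinear_bounded_linear]
  by (metis mult.commute)

end

lemma bounded_clinearI:
  assumes "\<And>x y. T (x + y) = T x + T y" "\<And>c x. T (c *\<^sub>C x) = c *\<^sub>C T x"
    and "\<And>x. norm (T x) \<le> K * norm x"
  shows "bounded_clinear T"
  unfolding bounded_clinear_def
proof (intro conjI allI bounded_linear_intro[where K = K])
  show "T (r *\<^sub>R x) = r *\<^sub>R T x" for r x
    by (simp add: scaleR_scaleC assms)
qed (simp_all add: assms mult.commute)

lemma bounded_clinear_id: "bounded_clinear (\<lambda>x. x)"
  by (rule bounded_clinearI[where K = 1]) simp_all

lemma bounded_clinear_comp:
  assumes "bounded_clinear S" "bounded_clinear T"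
  shows "bounded_clinear (\<lambda>x. S (T x))"
  using assms bounded_linear_compose unfolding bounded_clinear_def by auto

lemma bounded_clinear_plus:
  assumes "bounded_clinear S" "bounded_clinear T"
  shows "bounded_clinear (\<lambda>x. S x + T x)"
  using assms bounded_linear_add unfolding bounded_clinear_def by (auto simp: scaleC_add_right)

lemma bounded_clinear_cmul:
  assumes "bounded_clinear T"
  shows "bounded_clinear (\<lambda>x. c *\<^sub>C T x)"
proof -
  obtain K where K: "\<And>x. norm (T x) \<le> K * norm x"
    using bounded_clinear_bound[OF assms] by blast
  show ?thesis
  proof (rule bounded_clinearI[where K = "cmod c * K"])
    show "norm (c *\<^sub>C T x) \<le> cmod c * K * norm x" for x
      using mult_left_mono[OF K[of x], of "cmod c"] by (simp add: norm_scaleC mult.assoc)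
  qed (simp_all add: bounded_clinear_add[OF assms] bounded_clinear_scaleC[OF assms]
      scaleC_add_right mult.commute)
qed

lemma bounded_clinear_minus:
  assumes "bounded_clinear S" "bounded_clinear T"
  shows "bounded_clinear (\<lambda>x. S x - T x)"
  using bounded_clinear_plus[OF assms(1) bounded_clinear_cmul[OF assms(2), of "-1"]]
  by (simp add: scaleC_one)

lemmas bounded_clinear_intros =
  bounded_clinear_id bounded_clinear_minus bounded_clinear_plus bounded_clinear_cmul

section \<open>Quasinilpotent operators\<close>

text \<open>The inverse of \<open>1 - zT\<close> is used instead of that of \<open>c - T\<close>:
  with \<open>z = 1/c\<close> the family extends through \<open>z = 0\<close>, where it is the
  identity.\<close>

definition resolvent_at :: "('a :: complex_inner \<Rightarrow> 'a) \<Rightarrow> complex \<Rightarrow> ('a \<Rightarrow> 'a) \<Rightarrow> bool" where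
  "resolvent_at T z R \<longleftrightarrow> bounded_clinear R \<and>
     (\<forall>x. R x - z *\<^sub>C T (R x) = x) \<and> (\<forall>x. R (x - z *\<^sub>C T x) = x)"

lemma op_spectrum_subset_zero_iff:
  fixes T :: "'a :: complex_inner \<Rightarrow> 'a"
  assumes T: "bounded_clinear T"
  shows "op_spectrum T \<subseteq> {0} \<longleftrightarrow> (\<forall>z. \<exists>R. resolvent_at T z R)"
proof
  assume *: "op_spectrum T \<subseteq> {0}"
  show "\<forall>z. \<exists>R. resolvent_at T z R"
  proof
    fix z :: complex
    show "\<exists>R. resolvent_at T z R"
    proof (cases "z = 0")
      case True
      then have "resolvent_at T z (\<lambda>x. x)"
        by (simp add: resolvent_at_def bounded_clinear_id)
      then show ?thesis by blast
    next
      case False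
      then have "inverse z \<notin> op_spectrum T" using * by auto
      then obtain S where S: "bounded_clinear S"
        and "(\<lambda>x. inverse z *\<^sub>C x - T x) \<circ> S = id" "S \<circ> (\<lambda>x. inverse z *\<^sub>C x - T x) = id"
        unfolding op_spectrum_def by auto
      then have r: "inverse z *\<^sub>C S x - T (S x) = x" and l: "S (inverse z *\<^sub>C x - T x) = x" for x
        by (simp_all add: fun_eq_iff)
      have "resolvent_at T z (\<lambda>x. inverse z *\<^sub>C S x)"
        unfolding resolvent_at_def
      proof (intro conjI allI)
        show "inverse z *\<^sub>C S x - z *\<^sub>C T (inverse z *\<^sub>C S x) = x" for x
          using r[of x] False by (simp add: bounded_clinear_scaleC[OF T] scaleC_one)
        have "inverse z *\<^sub>C S (x - z *\<^sub>C T x) = S (inverse z *\<^sub>C x - T x)" for x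
          using False
          by (simp add: bounded_clinear_scaleC[OF S, symmetric]
              complex_vector.scale_right_diff_distrib scaleC_one)
        then show "inverse z *\<^sub>C S (x - z *\<^sub>C T x) = x" for x
          by (simp add: l)
      qed (intro bounded_clinear_intros bounded_clinear_comp[OF S])
      then show ?thesis by blast
    qed
  qed
next
  assume *: "\<forall>z. \<exists>R. resolvent_at T z R"
  show "op_spectrum T \<subseteq> {0}"
  proof (rule subsetI, rule ccontr)
    fix c assume c: "c \<in> op_spectrum T" "c \<notin> {0}"
    obtain R where R: "bounded_clinear R" and r: "\<And>x. R x - inverse c *\<^sub>C T (R x) = x"
      and l: "\<And>x. R (x - inverse c *\<^sub>C T x) = x"
      using * unfolding resolvent_at_def by blast
    define S where "S = (\<lambda>x. inverse c *\<^sub>C R x)"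
    have "bounded_clinear S"
      unfolding S_def by (intro bounded_clinear_intros bounded_clinear_comp[OF R])
    moreover have "c *\<^sub>C S x - T (S x) = x" for x
      using r[of x] c by (simp add: S_def bounded_clinear_scaleC[OF T] scaleC_one)
    moreover have "S (c *\<^sub>C x - T x) = x" for x
    proof -
      have "S (c *\<^sub>C x - T x) = R (x - inverse c *\<^sub>C T x)"
        using c by (simp add: S_def bounded_clinear_scaleC[OF R, symmetric]
            complex_vector.scale_right_diff_distrib scaleC_one)
      then show ?thesis by (simp add: l)
    qed
    ultimately have "c \<notin> op_spectrum T"
      unfolding op_spectrum_def by (auto simp: fun_eq_iff)
    with c show False by blast
  qed
qed

section \<open>Resolvents defined on the whole plane: bounds, analyticity, growth of powers\<close>

context
  fixes T :: "'a :: complex_inner \<Rightarrow> 'a" and R :: "complex \<Rightarrow> 'a \<Rightarrow> 'a"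
  assumes T: "bounded_clinear T" and R: "\<And>z. resolvent_at T z (R z)"
begin

lemma resolvent_bounded_clinear: "bounded_clinear (R z)"
  and resolvent_right: "R z x - z *\<^sub>C T (R z x) = x"
  and resolvent_left: "R z (x - z *\<^sub>C T x) = x"
  using R[of z] by (simp_all add: resolvent_at_def)

text \<open>Apply \<open>R w\<close> to \<open>x = (1 - zT) R z x\<close> and split
  \<open>1 - zT = (1 - wT) + (w - z)T\<close>.\<close>

lemma resolvent_identity: "R w x - R z x = (w - z) *\<^sub>C R w (T (R z x))"
proof -
  let ?v = "R z x"
  have "R w x = R w (?v - z *\<^sub>C T ?v)"
    by (simp add: resolvent_right)
  also have "?v - z *\<^sub>C T ?v = (?v - w *\<^sub>C T ?v) + (w - z) *\<^sub>C T ?v"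
    by (simp add: complex_vector.scale_left_diff_distrib)
  finally show ?thesis
    by (simp add: bounded_clinear_add[OF resolvent_bounded_clinear] resolvent_left
        bounded_clinear_scaleC[OF resolvent_bounded_clinear])
qed

lemma resolvent_locally_bounded:
  obtains d K where "d > 0" "K > 0" "\<And>w x. cmod (w - z) < d \<Longrightarrow> norm (R w x) \<le> K * norm x"
proof -
  obtain K where K: "K > 0" "\<And>x. norm (R z x) \<le> K * norm x"
    using bounded_clinear_bound[OF resolvent_bounded_clinear] by blast
  obtain t where t: "t > 0" "\<And>x. norm (T x) \<le> t * norm x"
    using bounded_clinear_bound[OF T] by blast
  \<comment> \<open>Chosen so that \<open>d * K * t = 1/2\<close>: the term in
    \<open>norm (R w x)\<close> on the right is then absorbed by the left side.\<close>
  define d where "d = 1 / (2 * K * t)"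
  have d: "d > 0" using K t by (simp add: d_def)
  have "norm (R w x) \<le> 2 * K * norm x" if w: "cmod (w - z) < d" for w x
  proof -
    \<comment> \<open>The identity is used with \<open>w\<close> and \<open>z\<close> exchanged, so
      that the outer factor is \<open>R z\<close>, whose bound is already known.\<close>
    have "R w x = R z x + (w - z) *\<^sub>C R z (T (R w x))"
      using resolvent_identity[of z x w]
      by (simp add: complex_vector.scale_left_diff_distrib algebra_simps)
    then have "norm (R w x) \<le> norm (R z x) + cmod (w - z) * norm (R z (T (R w x)))"
      by (metis norm_scaleC norm_triangle_ineq)
    also have "\<dots> \<le> K * norm x + d * (K * (t * norm (R w x)))"
    proof (intro add_mono mult_mono)
      show "norm (R z (T (R w x))) \<le> K * (t * norm (R w x))"
        by (rule order_trans[OF K(2)]) (intro mult_left_mono t(2) less_imp_le[OF K(1)])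
    qed (use w K d in auto)
    also have "\<dots> = K * norm x + norm (R w x) / 2"
      using K(1) t(1) by (simp add: d_def)
    finally show ?thesis by simp
  qed
  with d K(1) show thesis by (intro that[of d "2 * K"]) simp_all
qed

lemma resolvent_bounded_on_cball:
  obtains K where "K > 0" "\<And>z x. cmod z \<le> r \<Longrightarrow> norm (R z x) \<le> K * norm x"
proof -
  have "\<exists>d K. d > 0 \<and> K > 0 \<and> (\<forall>w x. cmod (w - z) < d \<longrightarrow> norm (R w x) \<le> K * norm x)" for z
    using resolvent_locally_bounded[of z] by metis
  then obtain d K where dK: "\<And>z. d z > 0" "\<And>z. K z > 0"
    "\<And>z w x. cmod (w - z) < d z \<Longrightarrow> norm (R w x) \<le> K z * norm x"
    by metis
  have "cball 0 r \<subseteq> (\<Union>z\<in>cball 0 r. ball z (d z))"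
    using dK(1) by (auto intro: centre_in_ball[THEN iffD2])
  then obtain F where F: "F \<subseteq> cball 0 r" "finite F" "cball 0 r \<subseteq> (\<Union>z\<in>F. ball z (d z))"
    using compactE_image[OF compact_cball, of "cball (0::complex) r" "\<lambda>z. ball z (d z)"]
    by (metis open_ball)
  \<comment> \<open>The sum dominates every local bound; the extra 1 keeps \<open>M\<close> positive
    if \<open>F\<close> is empty, as happens for \<open>r < 0\<close>.\<close>
  define M where "M = (\<Sum>z\<in>F. K z) + 1"
  have M0: "(\<Sum>z\<in>F. K z) \<ge> 0" using dK(2) by (intro sum_nonneg) (simp add: less_imp_le)
  have "norm (R w x) \<le> M * norm x" if w: "cmod w \<le> r" for w x
  proof -
    have "w \<in> cball 0 r" using w by simp
    then obtain z where z: "z \<in> F" "cmod (w - z) < d z"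
      using F(3) by (auto simp: dist_norm norm_minus_commute)
    have "norm (R w x) \<le> K z * norm x" using dK(3) z(2) .
    also have "K z \<le> M"
      using member_le_sum[of z F K] F(2) z(1) dK(2) by (fastforce simp: M_def less_imp_le)
    finally show ?thesis by (simp add: mult_right_mono)
  qed
  then show thesis using that[of M] M0 by (simp add: M_def)
qed

lemma resolvent_tendsto: "((\<lambda>w. R w x) \<longlongrightarrow> R z x) (at z)"
proof -
  obtain d K where dK: "d > 0" "K > 0" "\<And>w x. cmod (w - z) < d \<Longrightarrow> norm (R w x) \<le> K * norm x"
    using resolvent_locally_bounded by blast
  have "((\<lambda>w. R w x - R z x) \<longlongrightarrow> 0) (at z)"
  proof (rule Lim_null_comparison)
    show "\<forall>\<^sub>F w in at z. norm (R w x - R z x) \<le> cmod (w - z) * (K * norm (T (R z x)))"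
    proof (rule eventually_at[THEN iffD2], intro exI[of _ d] conjI ballI impI dK(1))
      fix w assume "w \<noteq> z \<and> dist w z < d"
      then have "norm (R w (T (R z x))) \<le> K * norm (T (R z x))"
        using dK(3) by (simp add: dist_norm)
      then show "norm (R w x - R z x) \<le> cmod (w - z) * (K * norm (T (R z x)))"
        by (simp add: resolvent_identity norm_scaleC mult_left_mono)
    qed
    show "((\<lambda>w. cmod (w - z) * (K * norm (T (R z x)))) \<longlongrightarrow> 0) (at z)"
      by (auto intro!: tendsto_eq_intros)
  qed
  then show ?thesis by (simp add: LIM_zero_iff)
qed

text \<open>By the resolvent identity the difference quotient is
  \<open>cinner (R w (T (R z x))) y\<close>, which converges by continuity of the resolvent. Pairing
  with \<open>y\<close> gives scalar functions, to which the maximum principle applies.\<close>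

lemma resolvent_holomorphic: "(\<lambda>z. cinner (R z x) y) holomorphic_on A"
proof (rule holomorphic_onI)
  fix z
  have "((\<lambda>w. cinner (R w (T (R z x))) y) \<longlongrightarrow> cinner (R z (T (R z x))) y) (at z)"
    by (intro tendsto_cinner_left resolvent_tendsto)
  moreover have "(cinner (R w x) y - cinner (R z x) y) / (w - z) = cinner (R w (T (R z x))) y"
    if "w \<noteq> z" for w
    using that
    by (simp add: cinner_diff_left[symmetric] resolvent_identity cinner_scaleC_left)
  ultimately have "((\<lambda>z. cinner (R z x) y) has_field_derivative cinner (R z (T (R z x))) y) (at z)"
    unfolding has_field_derivative_iff
    by (subst tendsto_cong) (auto simp: eventually_at intro: exI[of _ 1])
  then show "(\<lambda>z. cinner (R z x) y) field_differentiable at z within A"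
    using field_differentiable_def field_differentiable_at_within by blast
qed

text \<open>As \<open>z R(z) T v = R(z) v - v\<close>, multiplying the argument by \<open>T\<close> costs a factor \<open>2/r\<close> on the
  circle of radius \<open>r\<close>; the maximum principle propagates this to the disc.\<close>

lemma cinner_resolvent_funpow_le:
  assumes r: "r > 0" and K: "\<And>z x. cmod z \<le> r \<Longrightarrow> norm (R z x) \<le> K * norm x"
    and z: "cmod z \<le> r"
  shows "cmod (cinner (R z ((T ^^ n) x)) y) \<le> (2 / r) ^ n * (K * norm x * norm y)"
  using z
\<comment> \<open>The point \<open>z\<close> must vary: the induction step uses the bound on the
  circle and at the centre \<open>0\<close>, and these two uses produce the factor 2.\<close>
proof (induction n arbitrary: z)
  case 0
  show ?case
    using mult_right_mono[OF K[OF 0], of "norm y" x] norm_cinner_le[of "R z x" y] by simp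
next
  case (Suc n)
  let ?M = "(2 / r) ^ n * (K * norm x * norm y)"
  let ?v = "(T ^^ n) x"
  have circle: "cmod (cinner (R w (T ?v)) y) \<le> 2 / r * ?M" if w: "cmod w = r" for w
  proof -
    have "R w ?v - w *\<^sub>C R w (T ?v) = ?v"
      using resolvent_left[of w ?v]
      by (simp add: bounded_clinear_diff[OF resolvent_bounded_clinear]
          bounded_clinear_scaleC[OF resolvent_bounded_clinear])
    moreover have "R 0 ?v = ?v" using resolvent_right[of 0 ?v] by simp
    ultimately have "w *\<^sub>C R w (T ?v) = R w ?v - R 0 ?v" by (simp add: algebra_simps)
    then have "w * cinner (R w (T ?v)) y = cinner (R w ?v) y - cinner (R 0 ?v) y"
      by (metis cinner_scaleC_left cinner_diff_left)
    then have "r * cmod (cinner (R w (T ?v)) y) \<le> cmod (cinner (R w ?v) y) + cmod (cinner (R 0 ?v) y)"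
      using w by (metis norm_mult norm_triangle_ineq4)
    also have "\<dots> \<le> ?M + ?M"
      using Suc.IH[of w] Suc.IH[of 0] w r by (intro add_mono) auto
    finally show ?thesis using r by (simp add: field_simps)
  qed
  have "cmod (cinner (R z (T ?v)) y) \<le> 2 / r * ?M"
  proof (rule maximum_modulus_frontier[where f = "\<lambda>z. cinner (R z (T ?v)) y" and S = "cball 0 r"])
    show "continuous_on (closure (cball 0 r)) (\<lambda>z. cinner (R z (T ?v)) y)"
      by (intro holomorphic_on_imp_continuous_on resolvent_holomorphic)
  qed (use circle Suc.prems r in \<open>auto intro: resolvent_holomorphic\<close>)
  then show ?case by simp
qed

end

text \<open>Radius \<open>2 / e\<close> turns the factor \<open>2 / r\<close> into \<open>e\<close>.
  Evaluating at \<open>z = 0\<close>, where the resolvent is the identity, and pairing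
  \<open>(T ^^ n) x\<close> with itself gives the norm, with \<open>K\<close> independent of
  \<open>n\<close>.\<close>

lemma op_spectrum_zero_imp_power_bound:
  fixes T :: "'a :: complex_inner \<Rightarrow> 'a"
  assumes T: "bounded_clinear T" and sp: "op_spectrum T \<subseteq> {0}" and e: "e > 0"
  obtains K where "K > 0" "\<And>n x. norm ((T ^^ n) x) \<le> e ^ n * (K * norm x)"
proof -
  obtain R where R: "\<And>z. resolvent_at T z (R z)"
    using op_spectrum_subset_zero_iff[OF T] sp by metis
  obtain K where K: "K > 0" "\<And>z x. cmod z \<le> 2 / e \<Longrightarrow> norm (R z x) \<le> K * norm x"
    using resolvent_bounded_on_cball[OF T R] by blast
  have "norm ((T ^^ n) x) \<le> e ^ n * (K * norm x)" for n x
  proof -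
    let ?v = "(T ^^ n) x"
    have "R 0 ?v = ?v" using R[of 0] by (auto simp: resolvent_at_def)
    then have "cmod (cinner ?v ?v) \<le> e ^ n * (K * norm x * norm ?v)"
      using cinner_resolvent_funpow_le[OF T R _ K(2), of "2 / e" 0 n x ?v] e by simp
    then have "norm ?v * norm ?v \<le> (e ^ n * (K * norm x)) * norm ?v"
      by (simp add: cinner_self norm_mult power2_eq_square mult.assoc)
    moreover have "e ^ n * (K * norm x) \<ge> 0" using K(1) e by simp
    ultimately show ?thesis
      using mult_right_le_imp_le[of "norm ?v" "norm ?v"]
      by (cases "norm ?v = 0") auto
  qed
  with K(1) that show thesis by blast
qed

section \<open>Operator equations that force an operator to vanish\<close>

lemma geometric_bound_imp_zero:
  fixes x :: "'a :: real_normed_vector"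
  assumes "\<And>n. norm x \<le> (1 / 2) ^ n * (K :: real)"
  shows "x = 0"
proof -
  have "(\<lambda>n. (1 / 2) ^ n * K) \<longlonglongrightarrow> 0"
    by (intro tendsto_mult_left_zero LIMSEQ_power_zero) simp
  then have "norm x \<le> 0"
    by (rule LIMSEQ_le_const) (use assms in auto)
  then show ?thesis by simp
qed

lemma funpow_bound:
  fixes S :: "'a :: real_normed_vector \<Rightarrow> 'a"
  assumes "\<And>x. norm (S x) \<le> s * norm x" "s > 0"
  shows "norm ((S ^^ n) x) \<le> s ^ n * norm x"
proof (induction n)
  case (Suc n)
  have "norm ((S ^^ Suc n) x) \<le> s * norm ((S ^^ n) x)" by (simp add: assms)
  also have "\<dots> \<le> s * (s ^ n * norm x)" using Suc assms(2) by (intro mult_left_mono) auto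
  finally show ?case by (simp add: mult.assoc)
qed simp

text \<open>Iteration gives \<open>Z = S^n Z N^n\<close>; the growth of \<open>S^n\<close> is at
  most geometric and is beaten by the decay of \<open>N^n\<close>.\<close>

lemma quasinilpotent_right_intertwine_zero:
  fixes Z :: "'a :: complex_inner \<Rightarrow> 'b :: complex_inner"
  assumes S: "bounded_clinear S" and Z: "bounded_clinear Z" and N: "bounded_clinear N"
    and sp: "op_spectrum N \<subseteq> {0}" and eq: "\<And>x. Z x = S (Z (N x))"
  shows "Z x = 0"
proof -
  obtain s where s: "s > 0" "\<And>x. norm (S x) \<le> s * norm x" using bounded_clinear_bound[OF S] by blast
  obtain t where t: "t > 0" "\<And>x. norm (Z x) \<le> t * norm x" using bounded_clinear_bound[OF Z] by blast
  \<comment> \<open>The rate \<open>1 / (2 * s)\<close> leaves the ratio \<open>1 / 2\<close> after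
    multiplication by \<open>s\<close>.\<close>
  obtain K where K: "K > 0" "\<And>n x. norm ((N ^^ n) x) \<le> (1 / (2 * s)) ^ n * (K * norm x)"
    using op_spectrum_zero_imp_power_bound[OF N sp, of "1 / (2 * s)"] s(1) by auto
  have iter: "Z x = (S ^^ n) (Z ((N ^^ n) x))" for n
  proof (induction n)
    case (Suc n)
    then show ?case using eq[of "(N ^^ n) x"] by (simp add: funpow_swap1)
  qed simp
  have "norm (Z x) \<le> (1 / 2) ^ n * (t * K * norm x)" for n
  proof -
    have "norm (Z x) \<le> s ^ n * norm (Z ((N ^^ n) x))"
      using funpow_bound[OF s(2,1)] iter[of n] by simp
    also have "\<dots> \<le> s ^ n * (t * ((1 / (2 * s)) ^ n * (K * norm x)))"
      using s(1) t(1) by (intro mult_left_mono order_trans[OF t(2)] K(2)) auto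
    also have "\<dots> = (1 / 2) ^ n * (t * K * norm x)"
      using s(1) by (simp add: power_divide power_mult_distrib)
    finally show ?thesis .
  qed
  then show ?thesis by (rule geometric_bound_imp_zero)
qed

text \<open>Mirror image of the preceding argument, with \<open>Z = N^n Z S^n\<close>.\<close>

lemma quasinilpotent_left_intertwine_zero:
  fixes Z :: "'b :: complex_inner \<Rightarrow> 'a :: complex_inner"
  assumes S: "bounded_clinear S" and Z: "bounded_clinear Z" and N: "bounded_clinear N"
    and sp: "op_spectrum N \<subseteq> {0}" and eq: "\<And>x. Z x = N (Z (S x))"
  shows "Z x = 0"
proof -
  obtain s where s: "s > 0" "\<And>x. norm (S x) \<le> s * norm x" using bounded_clinear_bound[OF S] by blast
  obtain t where t: "t > 0" "\<And>x. norm (Z x) \<le> t * norm x" using bounded_clinear_bound[OF Z] by blast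
  obtain K where K: "K > 0" "\<And>n x. norm ((N ^^ n) x) \<le> (1 / (2 * s)) ^ n * (K * norm x)"
    using op_spectrum_zero_imp_power_bound[OF N sp, of "1 / (2 * s)"] s(1) by auto
  have iter: "Z x = (N ^^ n) (Z ((S ^^ n) x))" for n
  proof (induction n)
    case (Suc n)
    then show ?case using eq[of "(S ^^ n) x"] by (simp add: funpow_swap1)
  qed simp
  have "norm (Z x) \<le> (1 / 2) ^ n * (t * K * norm x)" for n
  proof -
    have "norm (Z x) \<le> (1 / (2 * s)) ^ n * (K * norm (Z ((S ^^ n) x)))"
      using K(2) iter[of n] by simp
    also have "\<dots> \<le> (1 / (2 * s)) ^ n * (K * (t * (s ^ n * norm x)))"
      using s(1) t(1) K(1)
      by (intro mult_left_mono order_trans[OF t(2)] funpow_bound[OF s(2,1)]) auto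
    also have "\<dots> = (1 / 2) ^ n * (t * K * norm x)"
      using s(1) by (simp add: power_divide power_mult_distrib)
    finally show ?thesis .
  qed
  then show ?thesis by (rule geometric_bound_imp_zero)
qed

text \<open>On the zero space every operator has empty spectrum; the vector \<open>v\<close>
  excludes this case. If \<open>0\<close> were not in the spectrum, the identity itself would
  satisfy the intertwining equation and hence vanish.\<close>

lemma quasinilpotent_if_op_spectrum_subset:
  fixes T :: "'a :: complex_inner \<Rightarrow> 'a"
  assumes T: "bounded_clinear T" and sp: "op_spectrum T \<subseteq> {0}" and nz: "(v :: 'a) \<noteq> 0"
  shows "quasinilpotent T"
proof -
  have "0 \<in> op_spectrum T"
  proof (rule ccontr)
    assume "0 \<notin> op_spectrum T"
    then obtain S where S: "bounded_clinear S" and "S \<circ> (\<lambda>x. 0 *\<^sub>C x - T x) = id"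
      unfolding op_spectrum_def by auto
    then have "x = S (- T x)" for x by (simp add: fun_eq_iff)
    then have "x = (-1) *\<^sub>C S (T x)" for x
      using bounded_clinear_scaleC[OF S, of "-1"] by (simp add: scaleC_one)
    then have "v = 0"
      by (intro quasinilpotent_right_intertwine_zero[where Z = "\<lambda>x. x" and N = T
            and S = "\<lambda>x. (-1) *\<^sub>C S x"] bounded_clinear_intros bounded_clinear_comp[OF S] T sp)
    with nz show False ..
  qed
  with sp show ?thesis by (auto simp: quasinilpotent_def)
qed

text \<open>Jacobson's formula: the inverse of \<open>1 - zWQ\<close> is
  \<open>1 + zW(1 - zQW)^{-1}Q\<close>.\<close>

lemma resolvent_at_swap:
  fixes Q :: "'a :: complex_inner \<Rightarrow> 'b :: complex_inner"
  assumes Q: "bounded_clinear Q" and W: "bounded_clinear W"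
    and R: "resolvent_at (\<lambda>y. Q (W y)) z R"
  shows "resolvent_at (\<lambda>x. W (Q x)) z (\<lambda>x. x + z *\<^sub>C W (R (Q x)))"
proof -
  have Rb: "bounded_clinear R" and r: "\<And>y. z *\<^sub>C Q (W (R y)) = R y - y"
    and l: "\<And>y. R (y - z *\<^sub>C Q (W y)) = y"
    using R by (auto simp: resolvent_at_def algebra_simps)
  have l': "z *\<^sub>C R (Q (W y)) = R y - y" for y
    using l[of y] by (simp add: bounded_clinear_diff[OF Rb] bounded_clinear_scaleC[OF Rb] algebra_simps)
  have right: "(x + z *\<^sub>C W (R (Q x))) - z *\<^sub>C W (Q (x + z *\<^sub>C W (R (Q x)))) = x" for x
    by (simp add: bounded_clinear_add[OF Q] bounded_clinear_scaleC[OF Q] r)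
  have left: "(x - z *\<^sub>C W (Q x)) + z *\<^sub>C W (R (Q (x - z *\<^sub>C W (Q x)))) = x" for x
    by (simp add: bounded_clinear_diff[OF Q] bounded_clinear_scaleC[OF Q] l)
  show ?thesis
    unfolding resolvent_at_def using right left
    by (intro conjI allI bounded_clinear_intros bounded_clinear_comp[OF Q]
        bounded_clinear_comp[OF W] bounded_clinear_comp[OF Rb]) simp_all
qed

text \<open>An inclusion, because the spectra of \<open>QW\<close> and \<open>WQ\<close> agree only
  away from \<open>0\<close>.\<close>

lemma op_spectrum_swap:
  assumes Q: "bounded_clinear Q" and W: "bounded_clinear W"
    and sp: "op_spectrum (\<lambda>y. Q (W y)) \<subseteq> {0}"
  shows "op_spectrum (\<lambda>x. W (Q x)) \<subseteq> {0}"
  using sp resolvent_at_swap[OF Q W]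
  unfolding op_spectrum_subset_zero_iff[OF bounded_clinear_comp[OF Q W]]
    op_spectrum_subset_zero_iff[OF bounded_clinear_comp[OF W Q]]
  by meson

section \<open>Uniqueness of generalized Drazin inverses\<close>

text \<open>With \<open>p = T S1\<close> and \<open>q = T S2\<close> idempotent,
  \<open>N = T(1 - q)\<close> has spectrum in \<open>{0}\<close>. The operators
  \<open>p(1 - q)\<close> and \<open>(1 - q)p\<close> satisfy \<open>Z = S1 Z N\<close> and
  \<open>Z = N Z S1\<close>, so both vanish.\<close>

lemma gdrazin_inverse_projections:
  fixes T :: "'a :: complex_inner \<Rightarrow> 'a"
  assumes T: "bounded_clinear T" and S1: "is_gdrazin_inverse T S1" and S2: "is_gdrazin_inverse T S2"
  shows "T (S1 x) = T (S1 (T (S2 x)))" and "T (S1 x) = T (S2 (T (S1 x)))"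
proof -
  have S1b: "bounded_clinear S1" and c1: "\<And>x. S1 (T x) = T (S1 x)"
    and i1: "\<And>x. T (S1 (S1 x)) = S1 x"
    using S1 unfolding is_gdrazin_inverse_def by (auto simp: fun_eq_iff)
  have S2b: "bounded_clinear S2" and c2: "\<And>x. S2 (T x) = T (S2 x)"
    and i2: "\<And>x. T (S2 (S2 x)) = S2 x"
    and q2: "op_spectrum (\<lambda>x. T x - T (T (S2 x))) \<subseteq> {0}"
    using S2 unfolding is_gdrazin_inverse_def quasinilpotent_def by (auto simp: fun_eq_iff)
  note lin = bounded_clinear_diff[OF T] bounded_clinear_diff[OF S1b] bounded_clinear_diff[OF S2b]
    bounded_clinear_zero[OF T] bounded_clinear_zero[OF S1b]
  have N: "bounded_clinear (\<lambda>x. T x - T (T (S2 x)))"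
    by (intro bounded_clinear_intros bounded_clinear_comp[OF T] bounded_clinear_comp[OF S2b])
  have "T (S1 x) - T (S1 (T (S2 x))) = 0"
  proof (rule quasinilpotent_right_intertwine_zero[OF S1b _ N q2,
        where Z = "\<lambda>x. T (S1 x) - T (S1 (T (S2 x)))"])
    show "bounded_clinear (\<lambda>x. T (S1 x) - T (S1 (T (S2 x))))"
      by (intro bounded_clinear_intros bounded_clinear_comp[OF T]
          bounded_clinear_comp[OF S1b] bounded_clinear_comp[OF S2b])
  qed (simp add: lin c1 c2 i1 i2)
  then show "T (S1 x) = T (S1 (T (S2 x)))" by simp
  have "T (S1 x) - T (S2 (T (S1 x))) = 0"
  proof (rule quasinilpotent_left_intertwine_zero[OF S1b _ N q2,
        where Z = "\<lambda>x. T (S1 x) - T (S2 (T (S1 x)))"])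
    show "bounded_clinear (\<lambda>x. T (S1 x) - T (S2 (T (S1 x))))"
      by (intro bounded_clinear_intros bounded_clinear_comp[OF T]
          bounded_clinear_comp[OF S1b] bounded_clinear_comp[OF S2b])
  qed (simp add: lin c1 c2 i1 i2)
  then show "T (S1 x) = T (S2 (T (S1 x)))" by simp
qed

lemma is_gdrazin_inverse_unique:
  assumes T: "bounded_clinear T" and S1: "is_gdrazin_inverse T S1" and S2: "is_gdrazin_inverse T S2"
  shows "S1 = S2"
proof
  fix x
  \<comment> \<open>Writing \<open>p\<close> and \<open>q\<close> for the two idempotents, the
    projection lemma gives \<open>p = qp\<close> and, with roles exchanged,
    \<open>q = qp\<close>.\<close>
  have e: "T (S1 x) = T (S2 x)" for x
    using gdrazin_inverse_projections[OF T S1 S2] gdrazin_inverse_projections[OF T S2 S1] by metis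
  have c: "S1 (T x) = T (S1 x)" "T (S1 (S1 x)) = S1 x" "S2 (T x) = T (S2 x)" "T (S2 (S2 x)) = S2 x" for x
    using S1 S2 unfolding is_gdrazin_inverse_def by (auto simp: fun_eq_iff)
  \<comment> \<open>The chain is
    \<open>S1 = S1 T S1 = S1 T S2 = T S1 S2 = T S2 S2 = S2\<close>.\<close>
  show "S1 x = S2 x"
    using c e by metis
qed

lemma gdrazin_inverse_eqI:
  assumes "bounded_clinear T" "is_gdrazin_inverse T S"
  shows "gdrazin_inverse T = S"
  unfolding gdrazin_inverse_def
  using assms is_gdrazin_inverse_unique by (intro the_equality) blast+

section \<open>From weighted to ordinary generalized Drazin inverses\<close>

context
  fixes W :: "'b :: complex_inner \<Rightarrow> 'a :: complex_inner" and A D :: "'a \<Rightarrow> 'b"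
  assumes W: "bounded_clinear W" and A: "bounded_clinear A" and D: "is_wgdrazin_inverse W A D"
begin

lemma wgdrazin_bounded_clinear: "bounded_clinear D"
  and wgdrazin_commute: "A (W (D x)) = D (W (A x))"
  and wgdrazin_outer: "D (W (A (W (D x)))) = D x"
  and wgdrazin_quasinilpotent: "quasinilpotent (\<lambda>y. A (W y) - A (W (D (W (A (W y))))))"
  using D unfolding is_wgdrazin_inverse_def comp_def fun_eq_iff by blast+

lemma wgdrazin_outer_left: "D (W (D (W (A x)))) = D x"
  using wgdrazin_outer[of x] by (simp only: wgdrazin_commute)

text \<open>The weighted condition on \<open>(A - AWDWA)W\<close> is literally the quasinilpotence
  required for \<open>AW\<close>, up to commuting factors.\<close>

lemma wgdrazin_imp_gdrazin_AW: "is_gdrazin_inverse (A \<circ> W) (D \<circ> W)"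
  using wgdrazin_quasinilpotent
  by (simp add: is_gdrazin_inverse_def comp_def wgdrazin_outer_left wgdrazin_commute
      bounded_clinear_comp[OF wgdrazin_bounded_clinear W])

text \<open>Here the required operator is \<open>WQ\<close> on the other space, while the definition
  controls \<open>QW\<close>; the spectral inclusion is carried over by exchanging the
  factors.\<close>

lemma wgdrazin_imp_gdrazin_WA:
  assumes nz: "(v :: 'a) \<noteq> 0"
  shows "is_gdrazin_inverse (W \<circ> A) (W \<circ> D)"
proof -
  let ?Q = "\<lambda>x. A x - A (W (D (W (A x))))"
  have Q: "bounded_clinear ?Q"
    by (intro bounded_clinear_intros bounded_clinear_comp[OF A] bounded_clinear_comp[OF W]
        bounded_clinear_comp[OF wgdrazin_bounded_clinear])
  have "op_spectrum (\<lambda>y. ?Q (W y)) \<subseteq> {0}"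
    using wgdrazin_quasinilpotent unfolding quasinilpotent_def by blast
  then have "quasinilpotent (\<lambda>x. W (?Q x))"
    using nz by (intro quasinilpotent_if_op_spectrum_subset[OF _ op_spectrum_swap[OF Q W]]
        bounded_clinear_comp[OF W Q])
  then show ?thesis
    by (simp add: is_gdrazin_inverse_def comp_def wgdrazin_outer_left wgdrazin_commute
        bounded_clinear_diff[OF W] bounded_clinear_comp[OF W wgdrazin_bounded_clinear])
qed

end

text \<open>Uniqueness for \<open>AW\<close> and \<open>WA\<close> fixes \<open>DW\<close> and
  \<open>WD\<close>, and \<open>D = (DW)A(WD)\<close> recovers \<open>D\<close> from them.\<close>

lemma is_wgdrazin_inverse_unique:
  fixes W :: "'b :: complex_inner \<Rightarrow> 'a :: complex_inner"
  assumes W: "bounded_clinear W" and A: "bounded_clinear A"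
    and D: "is_wgdrazin_inverse W A D" and E: "is_wgdrazin_inverse W A E"
    and nz: "(v :: 'a) \<noteq> 0"
  shows "D = E"
proof
  fix x
  have "bounded_clinear (A \<circ> W)" "bounded_clinear (W \<circ> A)"
    using bounded_clinear_comp A W by (auto simp: comp_def)
  then have "D \<circ> W = E \<circ> W" "W \<circ> D = W \<circ> E"
    using is_gdrazin_inverse_unique wgdrazin_imp_gdrazin_AW[OF W A] wgdrazin_imp_gdrazin_WA[OF W A _ nz]
      D E by blast+
  then have "D (W y) = E (W y)" "W (D x) = W (E x)" for y x
    by (simp_all add: fun_eq_iff)
  then show "D x = E x"
    using wgdrazin_outer[OF W A D] wgdrazin_outer[OF W A E] by metis
qed

section \<open>Orthogonal projections\<close>

lemma nearest_point_exists:
  fixes L :: "'a :: {real_inner, complete_space} set"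
  assumes L: "closed L" "subspace L"
  shows "\<exists>p\<in>L. \<forall>z\<in>L. norm (x - p) \<le> norm (x - z)"
proof -
  define d where "d = (INF z\<in>L. norm (x - z))"
  have ne: "L \<noteq> {}" using L(2) subspace_0 by blast
  have bdd: "bdd_below ((\<lambda>z. norm (x - z)) ` L)" by (intro bdd_belowI[of _ 0]) auto
  have dle: "d \<le> norm (x - z)" if "z \<in> L" for z
    unfolding d_def using bdd that by (rule cINF_lower)
  have d0: "d \<ge> 0" unfolding d_def using ne by (intro cINF_greatest) auto
  have "\<exists>z\<in>L. norm (x - z) < d + inverse (real (Suc n))" for n
    using cINF_less_iff[OF ne bdd, of "d + inverse (real (Suc n))"] by (simp add: d_def)
  then obtain p where p: "\<And>n. p n \<in> L" "\<And>n. norm (x - p n) < d + inverse (real (Suc n))"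
    by metis
  have lim: "(\<lambda>n. norm (x - p n)) \<longlonglongrightarrow> d"
  proof (rule tendsto_sandwich[where f = "\<lambda>_. d"])
    show "(\<lambda>n. d + inverse (real (Suc n))) \<longlonglongrightarrow> d"
      using tendsto_add[OF tendsto_const LIMSEQ_inverse_real_of_nat, of d] by simp
  qed (use p dle in \<open>auto intro: less_imp_le always_eventually\<close>)
  \<comment> \<open>Parallelogram law for \<open>x - a\<close> and \<open>x - b\<close>; the
    midpoint of \<open>a\<close> and \<open>b\<close> lies in \<open>L\<close>, so its distance to
    \<open>x\<close> is at least \<open>d\<close>.\<close>
  have par: "(norm (a - b))\<^sup>2 \<le> 2 * (norm (x - a))\<^sup>2 + 2 * (norm (x - b))\<^sup>2 - 4 * d\<^sup>2"
    if "a \<in> L" "b \<in> L" for a b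
  proof -
    have "(1 / 2) *\<^sub>R (a + b) \<in> L" using L(2) that by (simp add: subspace_add subspace_scale)
    then have "d\<^sup>2 \<le> (norm (x - (1 / 2) *\<^sub>R (a + b)))\<^sup>2"
      using d0 dle by (intro power_mono) auto
    moreover have "(norm (a - b))\<^sup>2 =
        2 * (norm (x - a))\<^sup>2 + 2 * (norm (x - b))\<^sup>2 - 4 * (norm (x - (1 / 2) *\<^sub>R (a + b)))\<^sup>2"
      by (simp add: power2_norm_eq_inner inner_diff inner_add inner_commute algebra_simps)
    ultimately show ?thesis by linarith
  qed
  have "Cauchy p"
  proof (rule metric_CauchyI)
    fix e :: real assume e: "e > 0"
    have "(\<lambda>n. (norm (x - p n))\<^sup>2) \<longlonglongrightarrow> d\<^sup>2" using lim by (rule tendsto_power)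
    then have "\<forall>\<^sub>F n in sequentially. (norm (x - p n))\<^sup>2 < d\<^sup>2 + e\<^sup>2 / 4"
      by (rule order_tendstoD(2)) (use e in simp)
    then obtain M where M: "\<And>n. n \<ge> M \<Longrightarrow> (norm (x - p n))\<^sup>2 < d\<^sup>2 + e\<^sup>2 / 4"
      unfolding eventually_sequentially by blast
    show "\<exists>M. \<forall>m\<ge>M. \<forall>n\<ge>M. dist (p m) (p n) < e"
    proof (intro exI allI impI)
      fix m n assume "m \<ge> M" "n \<ge> M"
      then have "(norm (p m - p n))\<^sup>2 < e\<^sup>2"
        using par[OF p(1) p(1), of m n] M[of m] M[of n] by linarith
      then show "dist (p m) (p n) < e"
        using e by (simp add: dist_norm power2_less_imp_less)
    qed
  qed
  then obtain q where q: "p \<longlonglongrightarrow> q" using Cauchy_convergent convergent_def by blast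
  then have "q \<in> L" using L(1) p(1) closed_sequentially by blast
  moreover have "norm (x - q) = d"
    using lim q by (intro LIMSEQ_unique[OF _ lim] tendsto_intros)
  ultimately show ?thesis using dle by auto
qed

lemma nearest_point_orthogonal:
  fixes L :: "'a :: real_inner set"
  assumes L: "subspace L" and p: "p \<in> L" "\<And>z. z \<in> L \<Longrightarrow> norm (x - p) \<le> norm (x - z)"
    and z: "z \<in> L"
  shows "inner (x - p) z = 0"
proof (cases "z = 0")
  case False
  \<comment> \<open>The coefficient minimizing the norm of \<open>x - p - t z\<close>; minimality of
    \<open>p\<close> then forces it to give no improvement.\<close>
  define t where "t = inner (x - p) z / inner z z"
  have "p + t *\<^sub>R z \<in> L" using L p(1) z by (simp add: subspace_add subspace_scale)
  then have "norm (x - p) \<le> norm ((x - p) - t *\<^sub>R z)" using p(2) by (simp add: diff_diff_eq)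
  then have "(norm (x - p))\<^sup>2 \<le> (norm ((x - p) - t *\<^sub>R z))\<^sup>2" by (intro power_mono) auto
  also have "\<dots> = (norm (x - p))\<^sup>2 - 2 * t * inner (x - p) z + t * (t * inner z z)"
    unfolding power2_norm_eq_inner by (simp add: inner_diff inner_commute algebra_simps)
  also have "t * inner z z = inner (x - p) z" using False by (simp add: t_def)
  finally have "t * inner (x - p) z \<le> 0" by simp
  then have "(inner (x - p) z)\<^sup>2 / inner z z \<le> 0" by (simp add: t_def power2_eq_square)
  moreover have "inner z z > 0" using False by simp
  ultimately have "(inner (x - p) z)\<^sup>2 \<le> 0" by (simp add: divide_le_0_iff)
  then show ?thesis by simp
qed simp

context
  fixes L :: "'a :: complex_hilbert set"
  assumes closed: "closed L" and sub: "complex_vector.subspace L"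
begin

lemma orth_proj_ex1: "\<exists>!p. p \<in> L \<and> (\<forall>z\<in>L. cinner (x - p) z = 0)"
proof (rule ex_ex1I)
  have rs: "subspace L"
    using sub unfolding complex_vector.subspace_def subspace_def by (simp add: scaleR_scaleC)
  obtain p where p: "p \<in> L" "\<And>z. z \<in> L \<Longrightarrow> norm (x - p) \<le> norm (x - z)"
    using nearest_point_exists[OF closed rs] by blast
  have re: "Re (cinner (x - p) z) = 0" if "z \<in> L" for z
    using nearest_point_orthogonal[OF rs p that] by (simp add: inner_eq_Re_cinner)
  have "cinner (x - p) z = 0" if "z \<in> L" for z
  proof (rule complex_eqI)
    \<comment> \<open>Nearest points give orthogonality only for the real part; testing against
      \<open>\<i> *\<^sub>C z\<close> yields the imaginary part.\<close>
    have "\<i> *\<^sub>C z \<in> L" using sub that complex_vector.subspace_scale by blast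
    from re[OF this] show "Im (cinner (x - p) z) = Im 0"
      by (simp add: cinner_scaleC_right)
  qed (use re that in simp)
  with p(1) show "\<exists>p. p \<in> L \<and> (\<forall>z\<in>L. cinner (x - p) z = 0)" by blast
next
  fix p q
  assume "p \<in> L \<and> (\<forall>z\<in>L. cinner (x - p) z = 0)" "q \<in> L \<and> (\<forall>z\<in>L. cinner (x - q) z = 0)"
  moreover from this have "q - p \<in> L" using sub complex_vector.subspace_diff by blast
  ultimately have "cinner ((x - p) - (x - q)) (q - p) = 0"
    by (simp only: cinner_diff_left) simp
  then show "p = q" by (simp add: cinner_self)
qed

lemma orth_proj_in: "orth_proj L x \<in> L"
  and orth_proj_orthogonal: "z \<in> L \<Longrightarrow> cinner (x - orth_proj L x) z = 0"
  using theI'[OF orth_proj_ex1[of x]] unfolding orth_proj_def by blast+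

lemma orth_proj_eqI: "p \<in> L \<Longrightarrow> (\<And>z. z \<in> L \<Longrightarrow> cinner (x - p) z = 0) \<Longrightarrow> orth_proj L x = p"
  using orth_proj_ex1[of x] orth_proj_in orth_proj_orthogonal by blast

lemma orth_proj_fixes: "x \<in> L \<Longrightarrow> orth_proj L x = x"
  by (rule orth_proj_eqI) (simp_all add: cinner_zero_left)

lemma bounded_clinear_orth_proj: "bounded_clinear (orth_proj L)"
proof (rule bounded_clinearI[where K = 1])
  show "orth_proj L (x + y) = orth_proj L x + orth_proj L y" for x y
  proof (rule orth_proj_eqI)
    fix z assume z: "z \<in> L"
    have "x + y - (orth_proj L x + orth_proj L y) = (x - orth_proj L x) + (y - orth_proj L y)"
      by simp
    then show "cinner (x + y - (orth_proj L x + orth_proj L y)) z = 0"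
      by (simp only: cinner_add_left orth_proj_orthogonal[OF z] add_0)
  qed (use sub orth_proj_in complex_vector.subspace_add in blast)
  show "orth_proj L (c *\<^sub>C x) = c *\<^sub>C orth_proj L x" for c x
  proof (rule orth_proj_eqI)
    fix z assume z: "z \<in> L"
    show "cinner (c *\<^sub>C x - c *\<^sub>C orth_proj L x) z = 0"
      by (simp add: complex_vector.scale_right_diff_distrib[symmetric] cinner_scaleC_left
          orth_proj_orthogonal[OF z])
  qed (use sub orth_proj_in complex_vector.subspace_scale in blast)
  show "norm (orth_proj L x) \<le> 1 * norm x" for x
  proof -
    let ?p = "orth_proj L x"
    have "cinner x ?p = cinner ?p ?p"
      using orth_proj_orthogonal[OF orth_proj_in, of x x] by (simp add: cinner_diff_left)
    then have "norm ?p * norm ?p \<le> norm x * norm ?p"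
      using norm_cinner_le[of x ?p] by (simp add: cinner_self norm_mult power2_eq_square)
    then show ?thesis by (cases "?p = 0") simp_all
  qed
qed

end

section \<open>The weighted core-EP inverse\<close>

text \<open>Since \<open>WAWD\<close> is idempotent with range \<open>R(WD)\<close>, this range is
  the kernel of a bounded operator, hence closed, and \<open>P\<close> is a genuine
  projector.\<close>

lemma wcep_inverse_eq:
  fixes W :: "'b :: complex_inner \<Rightarrow> 'a :: complex_hilbert"
  assumes W: "bounded_clinear W" and A: "bounded_clinear A" and D: "is_wgdrazin_inverse W A D"
    and nz: "(v :: 'a) \<noteq> 0"
  defines "P \<equiv> orth_proj (range (W \<circ> D))"
  shows "wcep_inverse W A = D \<circ> P" and "P (W (D x)) = W (D x)" and "W (A (W (D (P x)))) = P x"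
proof -
  note Db = wgdrazin_bounded_clinear[OF W A D] and com = wgdrazin_commute[OF W A D]
    and out = wgdrazin_outer[OF W A D]
  let ?L = "range (W \<circ> D)"
  have WAWD: "W (A (W (D (W (D x))))) = W (D x)" for x
    by (simp add: com wgdrazin_outer_left[OF W A D])
  have E: "bounded_clinear (\<lambda>x. x - W (A (W (D x))))"
    by (intro bounded_clinear_intros bounded_clinear_comp[OF W]
        bounded_clinear_comp[OF A] bounded_clinear_comp[OF Db])
  have L: "?L = {x. x - W (A (W (D x))) = 0}"
    using WAWD com by (auto simp: image_iff)
  have closed: "closed ?L"
    unfolding L
    by (intro closed_Collect_eq continuous_on_const
        linear_continuous_on bounded_clinear_bounded_linear[OF E])
  have sub: "complex_vector.subspace ?L"
    unfolding L complex_vector.subspace_def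
    using bounded_clinear_zero[OF E]
    by (simp add: bounded_clinear_add[OF E] bounded_clinear_scaleC[OF E] del: right_minus_eq)
  have Pb: "bounded_clinear P" unfolding P_def by (rule bounded_clinear_orth_proj[OF closed sub])
  show "P (W (D x)) = W (D x)" for x
    unfolding P_def by (rule orth_proj_fixes[OF closed sub]) auto
  show P: "W (A (W (D (P x)))) = P x" for x
  proof -
    have "P x \<in> ?L" unfolding P_def by (rule orth_proj_in[OF closed sub])
    then show ?thesis unfolding L by simp
  qed
  have b: "bounded_clinear (A \<circ> W)" "bounded_clinear (W \<circ> A)"
    using bounded_clinear_comp A W by (auto simp: comp_def)
  have g: "gdrazin_inverse (A \<circ> W) = D \<circ> W" "gdrazin_inverse (W \<circ> A) = W \<circ> D"
    by (rule gdrazin_inverse_eqI[OF b(1) wgdrazin_imp_gdrazin_AW[OF W A D]])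
      (rule gdrazin_inverse_eqI[OF b(2) wgdrazin_imp_gdrazin_WA[OF W A D nz]])
  show "wcep_inverse W A = D \<circ> P"
    unfolding wcep_inverse_def
  proof (rule the_equality)
    \<comment> \<open>The outer inverse identity writes \<open>D (P x)\<close> as \<open>DW\<close>
      applied to \<open>A (W (D (P x)))\<close>.\<close>
    have "D (P x) \<in> range (D \<circ> W)" for x
      using out[of "P x"] by (metis comp_apply rangeI)
    then show "is_wcep_inverse W A (D \<circ> P)"
      unfolding is_wcep_inverse_def g P_def[symmetric]
      using bounded_clinear_comp[OF Db Pb] P by (auto simp: comp_def)
  next
    fix C assume "is_wcep_inverse W A C"
    then have WAWC: "\<And>x. W (A (W (C x))) = P x" and ran: "range C \<subseteq> range (D \<circ> W)"
      unfolding is_wcep_inverse_def g P_def[symmetric] by (simp_all add: fun_eq_iff)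
    show "C = D \<circ> P"
    proof
      fix x
      \<comment> \<open>On \<open>R(DW)\<close> the operator \<open>DWAW\<close> is the identity, so
        \<open>C x = D (W (A (W (C x)))) = D (P x)\<close>.\<close>
      obtain y where "C x = D (W y)"
        using range_subsetD[OF ran, of x] by auto
      then show "C x = (D \<circ> P) x" using out[of "W y"] WAWC[of x] by simp
    qed
  qed
qed

section \<open>Algebraic equivalence of the four conditions\<close>

theorem theorem2p3:
  fixes W :: "'y :: complex_hilbert \<Rightarrow> 'x :: complex_hilbert"
    and A B :: "'x \<Rightarrow> 'y"
  assumes infdim_X: "\<not> (\<exists>S :: 'x set. finite S \<and> complex_vector.span S = UNIV)"
    and infdim_Y: "\<not> (\<exists>S :: 'y set. finite S \<and> complex_vector.span S = UNIV)"
    and W: "bounded_clinear W" "W \<noteq> (\<lambda>_. 0)"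
    and A: "bounded_clinear A" "wgdrazin_invertible W A"
    and B: "bounded_clinear B"
  shows "(B = wweak_group_inverse W A
            \<longleftrightarrow> wcep_inverse W A \<circ> W \<circ> A \<circ> W \<circ> B = B \<and> A \<circ> W \<circ> B = wcep_inverse W A \<circ> W \<circ> A) \<and>
         (B = wweak_group_inverse W A
            \<longleftrightarrow> B \<circ> W \<circ> A \<circ> W \<circ> B = B \<and> A \<circ> W \<circ> B = wcep_inverse W A \<circ> W \<circ> A \<and>
                B \<circ> W \<circ> wcep_inverse W A = wcep_inverse W A \<circ> W \<circ> wcep_inverse W A) \<and>
         (B = wweak_group_inverse W A
            \<longleftrightarrow> B \<circ> W \<circ> A \<circ> W \<circ> B = B \<and> A \<circ> W \<circ> B = wcep_inverse W A \<circ> W \<circ> A \<and>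
                B \<circ> W \<circ> wgdrazin_inverse W A = wgdrazin_inverse W A \<circ> W \<circ> wgdrazin_inverse W A)"
proof -
  \<comment> \<open>The nonzero weight supplies the nonzero vector of the first space that the
    uniqueness results ask for.\<close>
  obtain w where "W w \<noteq> 0" using W(2) by blast
  then obtain v :: 'x where nz: "v \<noteq> 0" by blast
  obtain D where D: "is_wgdrazin_inverse W A D"
    using A(2) unfolding wgdrazin_invertible_def by blast
  have wD: "wgdrazin_inverse W A = D"
    unfolding wgdrazin_inverse_def
    using D is_wgdrazin_inverse_unique[OF W(1) A(1) _ D nz] by (intro the_equality)
  define P where "P = orth_proj (range (W \<circ> D))"
  have C: "wcep_inverse W A = D \<circ> P" and PWD: "\<And>x. P (W (D x)) = W (D x)"
    and WAWDP: "\<And>x. W (A (W (D (P x)))) = P x"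
    using wcep_inverse_eq[OF W(1) A(1) D nz] by (simp_all add: P_def)
  note com = wgdrazin_commute[OF W(1) A(1) D] and out = wgdrazin_outer_left[OF W(1) A(1) D]
  have AWDWD: "A (W (D (W (D x)))) = D x" for x by (simp add: com out)
  \<comment> \<open>By commutation \<open>P x = W (D (W (A (P x))))\<close> lies in
    \<open>R(WD)\<close>, where \<open>P\<close> is the identity.\<close>
  have PP: "P (P x) = P x" for x by (metis PWD com WAWDP)
  have PWAWD: "P (W (A (W (D x)))) = W (A (W (D x)))" for x by (simp add: com PWD)
  \<comment> \<open>In \<open>DPWDPWA\<close> the left \<open>P\<close> meets \<open>WD\<close> and
    disappears.\<close>
  have weak: "wweak_group_inverse W A = (\<lambda>x. D (W (D (P (W (A x))))))"
    by (simp add: wweak_group_inverse_def C fun_eq_iff numeral_2_eq_2 PWD)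
  show ?thesis
    unfolding weak C wD
  proof (intro conjI iffI; (elim conjE)?)
    assume "D \<circ> P \<circ> W \<circ> A \<circ> W \<circ> B = B" "A \<circ> W \<circ> B = D \<circ> P \<circ> W \<circ> A"
    then have "B x = D (P (W (A (W (B x)))))" "A (W (B x)) = D (P (W (A x)))" for x
      by (simp_all add: fun_eq_iff)
    \<comment> \<open>Substituting the second equation into the first gives
      \<open>B = DPW(DPWA)\<close>, and \<open>PWD = WD\<close>.\<close>
    then show "B = (\<lambda>x. D (W (D (P (W (A x))))))"
      by (metis (no_types) ext PWD)
  next
    assume "B \<circ> W \<circ> A \<circ> W \<circ> B = B" "A \<circ> W \<circ> B = D \<circ> P \<circ> W \<circ> A"
      "B \<circ> W \<circ> (D \<circ> P) = D \<circ> P \<circ> W \<circ> (D \<circ> P)"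
    then have "B x = B (W (A (W (B x))))" "A (W (B x)) = D (P (W (A x)))"
      "B (W (D (P x))) = D (W (D (P x)))" for x
      by (simp_all add: fun_eq_iff PWD)
    \<comment> \<open>Here \<open>B = BW(AWB) = (BWDP)WA\<close>, and the third equation replaces
      \<open>BWDP\<close> by \<open>DWDP\<close>.\<close>
    then show "B = (\<lambda>x. D (W (D (P (W (A x))))))"
      by (metis (no_types) ext)
  next
    assume "B \<circ> W \<circ> A \<circ> W \<circ> B = B" "A \<circ> W \<circ> B = D \<circ> P \<circ> W \<circ> A"
      "B \<circ> W \<circ> D = D \<circ> W \<circ> D"
    then have "B x = B (W (A (W (B x))))" "A (W (B x)) = D (P (W (A x)))"
      "B (W (D x)) = D (W (D x))" for x
      by (simp_all add: fun_eq_iff)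
    \<comment> \<open>The same computation, with the third equation taken at the argument
      \<open>P (W (A x))\<close>.\<close>
    then show "B = (\<lambda>x. D (W (D (P (W (A x))))))"
      by (metis (no_types) ext)
  \<comment> \<open>What remains are the implications from the explicit formula for
    \<open>B\<close>, verified by rewriting.\<close>
  qed (simp_all add: fun_eq_iff AWDWD WAWDP PWD PP PWAWD com out)
qed

end
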